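(* For every real number $M$ there exists a multimodal (i.e. not unimodal) probability distribution on $\mathbb R$ with finite fourth moment and positive variance for which $\Delta=\kappa-\tau^2> M$, where $\tau$ is its skewness and $\kappa$ its kurtosis.
   Context: For a real random variable $X$ with finite fourth moment, mean $\mu$ and variance $\sigma^2>0$, the skewness is $\tau=E((X-\mu)^3)/\sigma^3$ and the kurtosis is $\kappa=E((X-\mu)^4)/\sigma^4$ (not the excess kurtosis). A distribution is unimodal if its distribution function $F$ is convex--concave, i.e. there is $m\in\mathbb R$ such that $F$ is convex on $(-\infty,m)$ and concave on $(m,\infty)$. *)

theory Defs
  imports "HOL-Probability.Probability"
begin

definition std_dev :: "'a measure \<Rightarrow> ('a \<Rightarrow> real) \<Rightarrow> real" where
  "std_dev M X = sqrt (prob_space.variance M X)"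

definition skewness :: "'a measure \<Rightarrow> ('a \<Rightarrow> real) \<Rightarrow> real" where
  "skewness M X =
    prob_space.expectation M (\<lambda>x. (X x - prob_space.expectation M X) ^ 3) / std_dev M X ^ 3"

(* Not the excess kurtosis: 3 is not subtracted. *)
definition kurtosis :: "'a measure \<Rightarrow> ('a \<Rightarrow> real) \<Rightarrow> real" where
  "kurtosis M X =
    prob_space.expectation M (\<lambda>x. (X x - prob_space.expectation M X) ^ 4) / std_dev M X ^ 4"

(* No condition at the mode m itself, so an atom at m is allowed. *)
definition unimodal :: "real measure \<Rightarrow> bool" where
  "unimodal P \<longleftrightarrow> (\<exists>m. convex_on {..<m} (cdf P) \<and> concave_on {m<..} (cdf P))"

end

theory Submission
  imports Defs
begin

text \<open>
  Mass \<open>1 - p\<close> at \<open>0\<close> and \<open>p / 2\<close> at each of \<open>-1\<close> and \<open>1\<close> gives a symmetric law, so the mean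
  and the skewness vanish, while the second and the fourth moment both equal \<open>p\<close>. Hence
  \<open>\<kappa> - \<tau>\<^sup>2 = p / p\<^sup>2 = 1 / p\<close>, which is arbitrarily large for small \<open>p\<close>. Three atoms are needed
  here, because every two-point law has \<open>\<kappa> - \<tau>\<^sup>2 = 1\<close>.

  The law is not unimodal because of its outer atoms: a distribution function that is convex (or
  concave) on an open interval is continuous there, and so cannot jump. A mode \<open>m \<le> 0\<close> would
  contradict the jump at \<open>1\<close>, a mode \<open>m > 0\<close> the one at \<open>-1\<close>.
\<close>

definition three_point_pmf :: "real \<Rightarrow> real pmf" where
  "three_point_pmf p = pmf_of_list [(-1, p/2), (0, 1 - p), (1, p/2)]"

text \<open>The image measure lives on the Borel sets, as a \<open>real_distribution\<close> must; the measure of a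
  pmf has every subset measurable.\<close>

definition three_point :: "real \<Rightarrow> real measure" where
  "three_point p = distr (measure_pmf (three_point_pmf p)) borel (\<lambda>x. x)"

lemma real_distribution_three_point: "real_distribution (three_point p)"
  unfolding three_point_def real_distribution_def real_distribution_axioms_def
  by (auto intro: measure_pmf.prob_space_distr)

context
  fixes p :: real
  assumes p: "0 < p" "p \<le> 1"
begin

lemma three_point_pmf_wf: "pmf_of_list_wf [(-1, p/2), (0, 1 - p), (1::real, p/2)]"
  using p by (auto simp: pmf_of_list_wf_def)

lemma set_three_point_pmf: "set_pmf (three_point_pmf p) \<subseteq> {-1, 0, 1}"
  unfolding three_point_pmf_def
  using set_pmf_of_list[OF three_point_pmf_wf] by simp

lemma integrable_three_point:
  fixes f :: "real \<Rightarrow> real"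
  assumes [measurable]: "f \<in> borel_measurable borel"
  shows "integrable (three_point p) f"
proof -
  have "finite (set_pmf (three_point_pmf p))"
    using set_three_point_pmf by (rule finite_subset) simp
  then show ?thesis
    unfolding three_point_def
    by (subst integrable_distr_eq) (auto intro: integrable_measure_pmf_finite)
qed

lemma expectation_three_point:
  fixes f :: "real \<Rightarrow> real"
  assumes [measurable]: "f \<in> borel_measurable borel"
  shows "integral\<^sup>L (three_point p) f = p/2 * f (-1) + (1 - p) * f 0 + p/2 * f 1"
proof -
  have "integral\<^sup>L (three_point p) f = integral\<^sup>L (measure_pmf (three_point_pmf p)) f"
    unfolding three_point_def by (subst integral_distr) auto
  also have "\<dots> = (\<Sum>a\<in>{-1, 0, 1}. f a * pmf (three_point_pmf p) a)"
    using set_three_point_pmf by (intro integral_measure_pmf_real) auto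
  also have "\<dots> = p/2 * f (-1) + (1 - p) * f 0 + p/2 * f 1"
    unfolding three_point_pmf_def by (simp add: pmf_pmf_of_list[OF three_point_pmf_wf] mult.commute)
  finally show ?thesis .
qed

lemma cdf_three_point:
  "cdf (three_point p) x =
    p/2 * indicator {..x} (-1) + (1 - p) * indicator {..x} 0 + p/2 * indicator {..x} 1"
proof -
  have "cdf (three_point p) x = integral\<^sup>L (three_point p) (indicator {..x})"
    unfolding cdf_def by (simp add: three_point_def)
  also have "\<dots> = p/2 * indicator {..x} (-1) + (1 - p) * indicator {..x} 0 + p/2 * indicator {..x} 1"
    by (rule expectation_three_point) simp
  finally show ?thesis .
qed

lemma not_unimodal_three_point: "\<not> unimodal (three_point p)"
proof
  let ?F = "cdf (three_point p)"
  assume "unimodal (three_point p)"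
  then obtain m where convex: "convex_on {..<m} ?F" and concave: "concave_on {m<..} ?F"
    unfolding unimodal_def by blast
  show False
  proof (cases "m \<le> 0")
    case True
    \<comment> \<open>\<open>3/4\<close> is the midpoint of \<open>1/2\<close> and \<open>1\<close>, and only the latter sees the jump.\<close>
    have "1/2 * ?F (1/2) + 1/2 * ?F 1 \<le> ?F (3/4)"
      using convex_onD[OF concave[unfolded concave_on_def], of "1/2" "1/2" 1] True by simp
    then show False using p by (simp add: cdf_three_point field_simps)
  next
    case False
    \<comment> \<open>The jump at \<open>-1\<close> is already reached at the midpoint, since a distribution function is
      continuous from the right.\<close>
    have "?F (-1) \<le> 1/2 * ?F (-3/2) + 1/2 * ?F (-1/2)"
      using convex_onD[OF convex, of "1/2" "-3/2" "-1/2"] False by simp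
    then show False using p by (simp add: cdf_three_point)
  qed
qed

lemma variance_three_point: "prob_space.variance (three_point p) (\<lambda>x. x) = p"
  by (simp add: expectation_three_point)

lemma skewness_three_point: "skewness (three_point p) (\<lambda>x. x) = 0"
  by (simp add: skewness_def expectation_three_point)

lemma kurtosis_three_point: "kurtosis (three_point p) (\<lambda>x. x) = 1 / p"
proof -
  have "sqrt p ^ 4 = (sqrt p ^ 2) ^ 2"
    by (simp flip: power_mult)
  also have "\<dots> = p ^ 2"
    using p by simp
  finally show ?thesis
    using p by (simp add: kurtosis_def std_dev_def expectation_three_point power2_eq_square)
qed

end

theorem mainTheorem4:
  fixes M :: real
  shows "\<exists>P :: real measure.
    real_distribution P \<and>
    integrable P (\<lambda>x. x ^ 4) \<and>
    prob_space.variance P (\<lambda>x. x) > 0 \<and>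
    \<not> unimodal P \<and>
    kurtosis P (\<lambda>x. x) - (skewness P (\<lambda>x. x))\<^sup>2 > M"
proof -
  define p where "p = 1 / (\<bar>M\<bar> + 1)"
  have p: "0 < p" "p \<le> 1" and "1 / p > M"
    by (auto simp: p_def)
  then show ?thesis
    by (intro exI[of _ "three_point p"])
      (simp add: real_distribution_three_point integrable_three_point not_unimodal_three_point
        variance_three_point skewness_three_point kurtosis_three_point)
qed

end
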